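(* For every integer $n \ge 3$, the Cayley-Menger determinant $\Gamma_n = \det(\mathrm{CM}_n)$ is an irreducible element of the polynomial ring $\mathbb{C}[d_{01}, d_{02}, \dots, d_{(n-1)\,n}]$.
   Context: For an integer $n\ge 1$ let $\{d_{ij} : 0\le i<j\le n\}$ be a set of $n(n+1)/2$ independent variables, and put $d_{ji}:=d_{ij}$. The matrix $\mathrm{CM}_n$ is the symmetric $(n+2)\times(n+2)$ matrix $$\mathrm{CM}_n := \begin{bmatrix} 0 & 1 & 1 & 1 & \cdots & 1\\ 1 & 0 & d_{01}^2 & d_{02}^2 & \cdots & d_{0n}^2\\ 1 & d_{01}^2 & 0 & d_{12}^2 & \cdots & d_{1n}^2\\ 1 & d_{02}^2 & d_{12}^2 & 0 & \cdots & d_{2n}^2\\ \vdots & & & & \ddots & \\ 1 & d_{0n}^2 & d_{1n}^2 & d_{2n}^2 & \cdots & 0\end{bmatrix},$$ that is, its first row and column are $(0,1,\dots,1)$, and the remaining $(n+1)\times(n+1)$ block, with rows and columns indexed by $0,\dots,n$, has zero diagonal and $(i,j)$ entry $d_{ij}^2$ for $i\ne j$. The Cayley-Menger determinant is the polynomial $\Gamma_n:=\det(\mathrm{CM}_n)\in\mathbb{Z}[d_{01},d_{02},\dots,d_{(n-1)\,n}]$. *)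

theory Defs
  imports
    "HOL-Library.Poly_Mapping"
    "HOL-Algebra.Ring_Divisibility"
    "Jordan_Normal_Form.Determinant"
begin

text \<open>
  Multivariate polynomials with variables in \<open>'v\<close> and coefficients in \<open>'a\<close> are finitely
  supported maps from monomials to coefficients, a monomial being a finitely supported map from
  variables to exponents. Multiplication on \<^typ>\<open>('v \<Rightarrow>\<^sub>0 nat) \<Rightarrow>\<^sub>0 'a::comm_ring_1\<close> is the
  convolution product, so this is the usual polynomial ring.
\<close>

type_synonym ('v, 'a) mpoly = "('v \<Rightarrow>\<^sub>0 nat) \<Rightarrow>\<^sub>0 'a"

definition mvar :: "'v \<Rightarrow> ('v, 'a::comm_ring_1) mpoly" where
  "mvar v = Poly_Mapping.single (Poly_Mapping.single v 1) 1"

text \<open>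
  The polynomial ring whose set of variables is exactly \<open>V\<close>. The restriction to \<open>V\<close> is needed
  because the number of variables depends on \<open>n\<close>, while the variable type below is fixed.
\<close>

definition mpoly_ring :: "'v set \<Rightarrow> ('v, 'a::comm_ring_1) mpoly ring" where
  "mpoly_ring V =
     \<lparr>carrier = {p. \<forall>m\<in>Poly_Mapping.keys p. Poly_Mapping.keys m \<subseteq> V},
      mult = (*), one = 1, zero = 0, add = (+)\<rparr>"

definition dist_vars :: "nat \<Rightarrow> (nat \<times> nat) set" where
  "dist_vars n = {(i, j). i < j \<and> j \<le> n}"

text \<open>The use of \<^const>\<open>min\<close> and \<^const>\<open>max\<close> implements the convention $d_{ji} = d_{ij}$.\<close>

definition dvar :: "nat \<Rightarrow> nat \<Rightarrow> (nat \<times> nat, 'a::comm_ring_1) mpoly" where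
  "dvar i j = mvar (min i j, max i j)"

text \<open>
  Row and column 0 are the border; row and column \<open>k + 1\<close> of the matrix belong to the index
  \<open>k \<in> {0..n}\<close>.
\<close>

definition CM :: "nat \<Rightarrow> (nat \<times> nat, 'a::comm_ring_1) mpoly mat" where
  "CM n = mat (n + 2) (n + 2) (\<lambda>(r, c).
     if r = c then 0
     else if r = 0 \<or> c = 0 then 1
     else (dvar (r - 1) (c - 1))\<^sup>2)"

definition cayley_menger :: "nat \<Rightarrow> (nat \<times> nat, 'a::comm_ring_1) mpoly" where
  "cayley_menger n = det (CM n)"

lemma mpoly_ring_simps [simp]:
  "mult (mpoly_ring V) = (*)" "one (mpoly_ring V) = 1"
  "zero (mpoly_ring V) = 0" "add (mpoly_ring V) = (+)"
  by (simp_all add: mpoly_ring_def)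

lemma mem_mpoly_ring:
  "p \<in> carrier (mpoly_ring V) \<longleftrightarrow> (\<forall>m\<in>Poly_Mapping.keys p. Poly_Mapping.keys m \<subseteq> V)"
  by (simp add: mpoly_ring_def)

lemma mpoly_ring_closed:
  fixes p q :: "('v, 'a::comm_ring_1) mpoly"
  shows "0 \<in> carrier (mpoly_ring V :: ('v, 'a) mpoly ring)"
    and "1 \<in> carrier (mpoly_ring V :: ('v, 'a) mpoly ring)"
    and "p \<in> carrier (mpoly_ring V) \<Longrightarrow> - p \<in> carrier (mpoly_ring V)"
    and "p \<in> carrier (mpoly_ring V) \<Longrightarrow> q \<in> carrier (mpoly_ring V) \<Longrightarrow> p + q \<in> carrier (mpoly_ring V)"
    and "p \<in> carrier (mpoly_ring V) \<Longrightarrow> q \<in> carrier (mpoly_ring V) \<Longrightarrow> p * q \<in> carrier (mpoly_ring V)"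
proof -
  show "0 \<in> carrier (mpoly_ring V :: ('v, 'a) mpoly ring)"
    and "1 \<in> carrier (mpoly_ring V :: ('v, 'a) mpoly ring)"
    by (auto simp: mem_mpoly_ring)
  show "- p \<in> carrier (mpoly_ring V)" if "p \<in> carrier (mpoly_ring V)"
    using that by (auto simp: mem_mpoly_ring in_keys_iff)
  show "p + q \<in> carrier (mpoly_ring V)"
    if "p \<in> carrier (mpoly_ring V)" "q \<in> carrier (mpoly_ring V)"
    using that keys_add[of p q] by (auto simp: mem_mpoly_ring)
  show "p * q \<in> carrier (mpoly_ring V)"
    if "p \<in> carrier (mpoly_ring V)" "q \<in> carrier (mpoly_ring V)"
    unfolding mem_mpoly_ring
  proof
    fix m assume "m \<in> Poly_Mapping.keys (p * q)"
    then obtain a b where "a \<in> Poly_Mapping.keys p" "b \<in> Poly_Mapping.keys q" "m = a + b"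
      using keys_mult[of p q] by blast
    then show "Poly_Mapping.keys m \<subseteq> V"
      using that keys_add[of a b] unfolding mem_mpoly_ring by blast
  qed
qed

lemma cring_mpoly_ring: "cring (mpoly_ring V :: ('v, 'a::comm_ring_1) mpoly ring)"
proof (rule cringI)
  show "abelian_group (mpoly_ring V :: ('v, 'a) mpoly ring)"
  proof (rule abelian_groupI)
    fix x :: "('v, 'a) mpoly"
    assume "x \<in> carrier (mpoly_ring V)"
    then show "\<exists>y\<in>carrier (mpoly_ring V). y \<oplus>\<^bsub>mpoly_ring V\<^esub> x = \<zero>\<^bsub>mpoly_ring V\<^esub>"
      by (intro bexI[of _ "- x"]) (auto intro: mpoly_ring_closed)
  qed (auto intro: mpoly_ring_closed simp: add_ac)
  show "comm_monoid (mpoly_ring V :: ('v, 'a) mpoly ring)"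
    by (rule comm_monoidI) (auto intro: mpoly_ring_closed simp: mult_ac)
qed (auto simp: distrib_right)

lemma domain_mpoly_ring: "domain (mpoly_ring V :: ('v::linorder, 'a::idom) mpoly ring)"
proof (rule domainI)
  show "cring (mpoly_ring V :: ('v, 'a) mpoly ring)" by (rule cring_mpoly_ring)
qed auto

end

theory Submission
  imports Defs "HOL-Library.Product_Lexorder"
begin

text \<open>
  Write \<open>\<Gamma>\<^sub>n\<close> for the Cayley-Menger determinant of the points \<open>0, \<dots>, n\<close> and \<open>\<Delta>\<^sub>n\<close> for the determinant
  of the same matrix without its border. Make the last point equidistant from the others by
  replacing all the variables \<open>d\<^sub>i\<^sub>n\<close> by a single variable \<open>s\<close>. Row and column operations show that
  \<open>\<Gamma>\<^sub>n\<close> becomes \<open>- 2 \<Gamma>\<^sub>n\<^sub>-\<^sub>1 s\<^sup>2 - \<Delta>\<^sub>n\<^sub>-\<^sub>1\<close>. (Geometrically, it vanishes when \<open>s\<close> is the circumradius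
  of the opposite face.) Since \<open>\<Gamma>\<^sub>n\<close> is homogeneous, so are its factors, and a nonconstant
  homogeneous polynomial does not specialize to a unit under a substitution by forms of degree 1.
  Hence it suffices that this quadratic polynomial in \<open>s\<close> is irreducible
  (\<open>irreducible_if_specialization_irreducible\<close>).

  A polynomial \<open>G s\<^sup>2 + H\<close> over a domain is irreducible if \<open>G\<close> and \<open>H\<close> have no common divisors except
  units, and \<open>G\<close> is irreducible or has a prime divisor of multiplicity one
  (\<open>irreducible_quadratic\<close>). This gives an induction on \<open>n\<close>. If \<open>\<Gamma>\<^sub>n\<^sub>-\<^sub>1\<close> is irreducible, it
  remains to see that it does not divide \<open>\<Delta>\<^sub>n\<^sub>-\<^sub>1\<close>; a regular simplex together with its
  circumcentre is a configuration where \<open>\<Gamma>\<^sub>n\<^sub>-\<^sub>1\<close> vanishes and \<open>\<Delta>\<^sub>n\<^sub>-\<^sub>1\<close> does not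
  (\<open>simplex_with_circumcentre\<close>). The induction starts at \<open>n = 3\<close>, where \<open>\<Gamma>\<^sub>2\<close> is Heron's product
  \<open>- (a + b + c)(b + c - a)(a + c - b)(a + b - c)\<close>, with the prime divisor \<open>a + b + c\<close> of
  multiplicity one, and \<open>\<Delta>\<^sub>2 = 2 (a b c)\<^sup>2\<close> has no factor in common with it
  (\<open>irreducible_cayley_menger_3\<close>).

  All of this takes place in the ring of polynomials in all variables \<open>d\<^sub>i\<^sub>j\<close>. The
  lexicographic order on index pairs only serves to make that ring an integral domain.
\<close>

section \<open>Substitution homomorphisms\<close>

definition const :: "'a::comm_ring_1 \<Rightarrow> ('v, 'a) mpoly" where
  "const c = Poly_Mapping.single 0 c"

definition eval_monom :: "('v \<Rightarrow> 'b::comm_ring_1) \<Rightarrow> ('v \<Rightarrow>\<^sub>0 nat) \<Rightarrow> 'b" where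
  "eval_monom f m = (\<Prod>v\<in>Poly_Mapping.keys m. f v ^ Poly_Mapping.lookup m v)"

text \<open>
  The homomorphism out of the polynomial ring that acts as \<open>h\<close> on coefficients and sends the
  variable \<open>v\<close> to \<open>f v\<close>. Every specialization, evaluation and change of variables below is an
  instance.
\<close>

definition subst :: "('a::comm_ring_1 \<Rightarrow> 'b::comm_ring_1) \<Rightarrow> ('v \<Rightarrow> 'b) \<Rightarrow> ('v, 'a) mpoly \<Rightarrow> 'b" where
  "subst h f p = (\<Sum>m\<in>Poly_Mapping.keys p. h (Poly_Mapping.lookup p m) * eval_monom f m)"

lemma eval_monom_superset:
  assumes "finite S" "Poly_Mapping.keys m \<subseteq> S"
  shows "eval_monom f m = (\<Prod>v\<in>S. f v ^ Poly_Mapping.lookup m v)"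
  unfolding eval_monom_def
  by (rule prod.mono_neutral_left) (use assms in \<open>auto simp: in_keys_iff\<close>)

lemma eval_monom_add: "eval_monom f (a + b) = eval_monom f a * eval_monom f b"
proof -
  let ?S = "Poly_Mapping.keys a \<union> Poly_Mapping.keys b"
  have "eval_monom f (a + b) = (\<Prod>v\<in>?S. f v ^ Poly_Mapping.lookup (a + b) v)"
    by (rule eval_monom_superset) (use keys_add[of a b] in auto)
  also have "\<dots> = (\<Prod>v\<in>?S. f v ^ Poly_Mapping.lookup a v) * (\<Prod>v\<in>?S. f v ^ Poly_Mapping.lookup b v)"
    by (simp add: lookup_add power_add prod.distrib)
  also have "\<dots> = eval_monom f a * eval_monom f b"
    by (simp add: eval_monom_superset[of ?S])
  finally show ?thesis .
qed

lemma mpoly_monomial_induct [case_names add monomial]: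
  fixes p :: "('v, 'a::comm_ring_1) mpoly"
  assumes add: "\<And>p q. P p \<Longrightarrow> P q \<Longrightarrow> P (p + q)"
    and single: "\<And>m c. P (Poly_Mapping.single m c)"
  shows "P p"
proof (induction p rule: update_induct)
  case const
  show ?case using single[of 0 0] by simp
next
  case (update p m c)
  have "Poly_Mapping.update m c p = p + Poly_Mapping.single m c"
    by (rule poly_mapping_eqI)
       (use update in \<open>auto simp: lookup_update lookup_add lookup_single in_keys_iff when_def\<close>)
  then show ?case using add update single by metis
qed

context comm_ring_hom
begin

lemma subst_superset:
  assumes "finite S" "Poly_Mapping.keys p \<subseteq> S"
  shows "subst hom f p = (\<Sum>m\<in>S. hom (Poly_Mapping.lookup p m) * eval_monom f m)"
  unfolding subst_def
  by (rule sum.mono_neutral_left) (use assms in \<open>auto simp: in_keys_iff\<close>)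

lemma subst_add: "subst hom f (p + q) = subst hom f p + subst hom f q"
proof -
  let ?S = "Poly_Mapping.keys p \<union> Poly_Mapping.keys q"
  have "subst hom f (p + q)
      = (\<Sum>m\<in>?S. hom (Poly_Mapping.lookup (p + q) m) * eval_monom f m)"
    by (rule subst_superset) (use keys_add[of p q] in auto)
  then show ?thesis
    by (simp add: subst_superset[of ?S] lookup_add hom_add distrib_right sum.distrib)
qed

lemma subst_single: "subst hom f (Poly_Mapping.single m c) = hom c * eval_monom f m"
  by (simp add: subst_def)

lemma subst_mult: "subst hom f (p * q) = subst hom f p * subst hom f q"
proof (induction p rule: mpoly_monomial_induct)
  case (monomial m c)
  show ?case
    by (induction q rule: mpoly_monomial_induct)
       (simp_all add: distrib_left distrib_right subst_add mult_single subst_single eval_monom_add hom_mult mult_ac)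
qed (simp add: distrib_left distrib_right subst_add)

lemma comm_ring_hom_subst: "comm_ring_hom (subst hom f)"
proof
  show "subst hom f 0 = 0" by (simp add: subst_def)
  show "subst hom f 1 = 1"
    using subst_single[of f 0 1] by (simp add: eval_monom_def)
qed (auto simp: subst_add subst_mult)

lemma subst_mvar: "subst hom f (mvar v) = f v"
  by (simp add: mvar_def subst_single eval_monom_def)

lemma subst_const: "subst hom f (const c) = hom c"
  by (simp add: const_def subst_single eval_monom_def)

end

lemma comm_ring_hom_const: "comm_ring_hom (const :: 'a::comm_ring_1 \<Rightarrow> ('v, 'a) mpoly)"
  by standard (simp_all add: const_def single_add mult_single)

lemma single_eq_const_mvars:
  fixes c :: "'a::comm_ring_1" and m :: "'v \<Rightarrow>\<^sub>0 nat"
  shows "Poly_Mapping.single m c = const c * eval_monom mvar m"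
proof -
  have "eval_monom mvar m = Poly_Mapping.single m (1::'a)"
  proof (induction m rule: update_induct)
    case const show ?case by (simp add: eval_monom_def)
  next
    case (update m v k)
    have *: "mvar v ^ k = Poly_Mapping.single (Poly_Mapping.single v k) (1::'a)" for k and v :: 'v
      by (induction k) (simp_all add: mvar_def mult_single flip: single_add)
    have "Poly_Mapping.update v k m = Poly_Mapping.single v k + m"
      by (rule poly_mapping_eqI)
       (use update in \<open>auto simp: lookup_update lookup_add lookup_single in_keys_iff when_def\<close>)
    moreover have "eval_monom mvar (Poly_Mapping.single v k) = (mvar v ^ k :: ('v,'a) mpoly)"
      by (simp add: eval_monom_def)
    ultimately show ?case using update by (simp add: eval_monom_add * mult_single)
  qed
  then show ?thesis by (simp add: const_def mult_single)
qed

text \<open>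
  The form of induction that suits ring homomorphisms: it mentions only constants, variables and
  the two ring operations.
\<close>

lemma mpoly_generator_induct [case_names const mvar add mult]:
  fixes p :: "('v, 'a::comm_ring_1) mpoly"
  assumes const: "\<And>c. P (const c)" and mvar: "\<And>v. P (mvar v)"
    and add: "\<And>p q. P p \<Longrightarrow> P q \<Longrightarrow> P (p + q)"
    and mult: "\<And>p q. P p \<Longrightarrow> P q \<Longrightarrow> P (p * q)"
  shows "P p"
proof (induction p rule: mpoly_monomial_induct)
  case (monomial m c)
  have one: "P 1"
    using const[of 1] by (simp add: const_def)
  have power: "P (mvar v ^ k)" for v and k :: nat
    by (induction k) (simp_all add: one mvar mult)
  have "P (\<Prod>v\<in>S. mvar v ^ Poly_Mapping.lookup m v)" if "finite S" for S
    using that by (induction S) (simp_all add: one power mult)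
  then show ?case
    by (simp add: single_eq_const_mvars eval_monom_def const mult)
qed (rule add)

text \<open>
  Used to identify composites of substitutions without computing with monomials.
\<close>

lemma hom_mpoly_eqI:
  assumes "comm_ring_hom g" and "comm_ring_hom h"
    and "\<And>c. g (const c) = h (const c)" and "\<And>v. g (mvar v) = h (mvar v)"
  shows "g p = h p"
proof -
  interpret g: comm_ring_hom g by fact
  interpret h: comm_ring_hom h by fact
  show ?thesis
    by (induction p rule: mpoly_generator_induct)
       (simp_all add: assms(3,4) g.hom_add h.hom_add g.hom_mult h.hom_mult)
qed

lemma comm_ring_hom_id: "comm_ring_hom (\<lambda>x. x)"
  by standard simp_all

lemma comm_ring_hom_comp:
  assumes "comm_ring_hom g" and "comm_ring_hom h"
  shows "comm_ring_hom (\<lambda>x. g (h x))"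
proof -
  interpret g: comm_ring_hom g by fact
  interpret h: comm_ring_hom h by fact
  show ?thesis
    by standard (simp_all add: g.hom_add h.hom_add g.hom_mult h.hom_mult)
qed

lemma comm_ring_hom_poly: "comm_ring_hom (\<lambda>p. poly p x)"
  by standard simp_all

lemma comm_ring_hom_pCons: "comm_ring_hom (\<lambda>c. [:c:])"
  by standard (simp_all add: one_pCons)

lemma hom_dvd_one:
  assumes "comm_ring_hom h" and "x dvd 1"
  shows "h x dvd 1"
proof -
  interpret h: comm_ring_hom h by fact
  from \<open>x dvd 1\<close> obtain y where "1 = x * y" by (rule dvdE)
  then have "1 = h x * h y" by (metis h.hom_mult h.hom_one)
  then show ?thesis by (rule dvdI)
qed


section \<open>Primes and irreducible quadratic polynomials\<close>

lemma dvd_cancel_prime_factor: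
  fixes p u x :: "'a::idom"
  assumes "prime_elem p" and "\<not> p dvd u" and "u dvd p * x"
  shows "u dvd x"
proof -
  obtain v where v: "p * x = u * v" using assms(3) by (rule dvdE)
  then have "p dvd u * v" by (metis dvd_triv_left)
  then have "p dvd v" using assms(1,2) by (auto simp: prime_elem_dvd_mult_iff)
  then obtain w where "v = p * w" by (rule dvdE)
  with v have "p * x = p * (u * w)" by (simp add: mult_ac)
  then have "x = u * w" using assms(1) by (auto simp: prime_elem_def)
  then show ?thesis by simp
qed

text \<open>
  The congruence says that \<open>r\<close> changes nothing modulo \<open>p\<close>, so the kernel of \<open>r\<close> is exactly the
  ideal generated by \<open>p\<close>; the quotient embeds into a domain.
\<close>

lemma prime_elem_if_retract:
  fixes p :: "'a::idom"
  assumes "comm_ring_hom r" and "p \<noteq> 0" and "r p = 0" and cong: "\<And>q. p dvd q - r q"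
  shows "prime_elem p"
proof (rule prime_elemI)
  interpret r: comm_ring_hom r by fact
  show "p \<noteq> 0" by fact
  show "\<not> p dvd 1"
    using hom_dvd_one[OF assms(1), of p] assms(3) by auto
  show "p dvd a \<or> p dvd b" if "p dvd a * b" for a b
  proof -
    obtain c where "a * b = p * c" using \<open>p dvd a * b\<close> by (rule dvdE)
    then have "r a * r b = 0" by (metis r.hom_mult assms(3) mult_zero_left)
    then have "r a = 0 \<or> r b = 0" by simp
    then show ?thesis using cong[of a] cong[of b] by auto
  qed
qed

lemma dvd_diff_mult:
  fixes p a b a' b' :: "'a::comm_ring_1"
  assumes "p dvd a - a'" "p dvd b - b'"
  shows "p dvd a * b - a' * b'"
proof -
  have "a * b - a' * b' = (a - a') * b + a' * (b - b')" by (simp add: algebra_simps)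
  then show ?thesis using assms by simp
qed

text \<open>
  If substituting \<open>f\<close> solves the equation \<open>p = 0\<close>, as when a linear form is solved for one of its
  variables, then \<open>p\<close> is prime. The congruence needs to be checked on variables only, since it is
  compatible with sums and products.
\<close>

lemma prime_elem_mpolyI:
  fixes p :: "('v::linorder, 'a::idom) mpoly"
  assumes "p \<noteq> 0" and "subst const f p = 0" and "\<And>v. p dvd mvar v - f v"
  shows "prime_elem p"
proof (rule prime_elem_if_retract[where r = "subst const f"])
  interpret const: comm_ring_hom "const :: 'a \<Rightarrow> ('v, 'a) mpoly" by (rule comm_ring_hom_const)
  interpret r: comm_ring_hom "subst const f" by (rule const.comm_ring_hom_subst)
  show "comm_ring_hom (subst const f)" by (rule r.comm_ring_hom_axioms)
  show "p dvd q - subst const f q" for q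
  proof (induction q rule: mpoly_generator_induct)
    case (add q q')
    then have "p dvd (q - subst const f q) + (q' - subst const f q')" by (rule dvd_add)
    then show ?case by (simp add: r.hom_add algebra_simps)
  qed (simp_all add: const.subst_const const.subst_mvar assms(3) r.hom_mult dvd_diff_mult)
qed (use assms in auto)

lemma dvd_unit_cancel:
  fixes l x y :: "'a::comm_semiring_1"
  assumes "y dvd 1" and "l dvd x * y"
  shows "l dvd x"
proof -
  obtain z where z: "1 = y * z" using assms(1) by (rule dvdE)
  have "l dvd x * y * z" using assms(2) by (rule dvd_mult2)
  also have "x * y * z = x" using z by (metis mult.assoc mult.right_neutral)
  finally show ?thesis .
qed

text \<open>
  A quadratic polynomial \<open>G x\<^sup>2 + H\<close> without linear term. Coprimality excludes constant factors.
  In a splitting \<open>(a x + b)(c x + d)\<close> the coefficient of \<open>x\<close> gives \<open>a d = - b c\<close>. A non-unit \<open>l\<close>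
  that divides \<open>a\<close> and can be cancelled against \<open>c\<close> therefore divides \<open>b\<close>, so it divides both
  \<open>G = a c\<close> and \<open>H = b d\<close>, which is impossible. Such an \<open>l\<close> exists (up to exchanging the factors) if
  \<open>G\<close> is irreducible, namely \<open>l = a\<close> when \<open>c\<close> is a unit, and if \<open>l\<close> is a prime dividing \<open>G\<close> exactly
  once. The latter is Eisenstein's criterion for the reversed polynomial; the former is the
  alternative that an induction on irreducibility can supply.
\<close>

lemma irreducible_quadratic:
  fixes G H :: "'a::idom"
  assumes "G \<noteq> 0" and coprime: "\<And>u. u dvd G \<Longrightarrow> u dvd H \<Longrightarrow> u dvd 1"
    and G: "Factorial_Ring.irreducible G \<or> (\<exists>l. prime_elem l \<and> l dvd G \<and> \<not> l\<^sup>2 dvd G)"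
  shows "Factorial_Ring.irreducible [:H, 0, G:]"
proof (rule Factorial_Ring.irreducibleI)
  show "[:H, 0, G:] \<noteq> 0" using \<open>G \<noteq> 0\<close> by simp
  show "\<not> [:H, 0, G:] dvd 1" using \<open>G \<noteq> 0\<close> by (auto simp: is_unit_poly_iff)
  have nonunit: "\<not> u dvd H" if "u dvd G" "\<not> u dvd 1" for u
    using that coprime by blast
  have const_factor: "p dvd 1" if pq: "[:H, 0, G:] = p * q" and deg: "Polynomial.degree p = 0" for p q
  proof -
    obtain u where u: "p = [:u:]" using deg by (rule degree_eq_zeroE)
    then have "\<forall>k. u dvd Polynomial.coeff [:H, 0, G:] k"
      using pq by (metis const_poly_dvd_iff dvd_triv_left)
    from this[rule_format, of 0] this[rule_format, of 2] have "u dvd H" "u dvd G"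
      by (simp_all add: numeral_2_eq_2)
    then have "u dvd 1" using nonunit by blast
    then show ?thesis unfolding u by (rule hom_dvd_one[OF comm_ring_hom_pCons])
  qed
  have no_linear: False
    if "a * c = G" "a * d + b * c = 0" "b * d = H"
      and l: "l dvd a" "\<not> l dvd 1" "\<And>x. l dvd x * c \<Longrightarrow> l dvd x"
    for a b c d l
  proof -
    have "l dvd b * c"
      using that(2) l(1) by (metis dvd_add_right_iff dvd_0_right dvd_mult2)
    then have "l dvd H" using l(3)[of b] that(3) by (metis dvd_mult2)
    moreover have "l dvd G" using l(1) that(1) by (metis dvd_mult2)
    ultimately show False using nonunit l(2) by blast
  qed
  show "p dvd 1 \<or> q dvd 1" if pq: "[:H, 0, G:] = p * q" for p q
  proof (rule ccontr)
    assume neither: "\<not> (p dvd 1 \<or> q dvd 1)"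
    have "p \<noteq> 0" "q \<noteq> 0" using pq \<open>G \<noteq> 0\<close> by auto
    then have "Polynomial.degree p + Polynomial.degree q = 2"
      using pq \<open>G \<noteq> 0\<close> by (metis (no_types, lifting) degree_mult_eq degree_pCons_eq degree_0 degree_pCons_0 pCons_eq_0_iff Suc_1 One_nat_def)
    moreover have "[:H, 0, G:] = q * p" using pq by (simp only: mult.commute)
    then have "Polynomial.degree p \<noteq> 0" "Polynomial.degree q \<noteq> 0"
      using neither const_factor pq by blast+
    ultimately have "Polynomial.degree p = 1" "Polynomial.degree q = 1" by auto
    then obtain a b c d where p: "p = [:b, a:]" and q: "q = [:d, c:]"
      by (meson degree1_coeffs)
    have eqs: "a * c = G" "a * d + b * c = 0" "b * d = H"
      using pq by (auto simp: p q algebra_simps)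
    have eqs': "c * a = G" "c * b + d * a = 0" "d * b = H"
      using eqs by (simp_all add: algebra_simps)
    from G show False
    proof
      assume irr: "Factorial_Ring.irreducible G"
      show False
      proof (cases "c dvd 1")
        case True
        then have "\<not> a dvd 1" using irr eqs(1) mult_dvd_mono[of a 1 c 1]
          by (auto simp: Factorial_Ring.irreducible_def)
        moreover have "a dvd x" if "a dvd x * c" for x
          using that by (rule dvd_unit_cancel[OF True])
        ultimately show False by (rule no_linear[OF eqs dvd_refl])
      next
        case False
        then have "a dvd 1" using irr eqs(1)
          by (auto simp: Factorial_Ring.irreducible_def)
        then have "c dvd x" if "c dvd x * a" for x
          using that by (rule dvd_unit_cancel)
        with False show False by (rule no_linear[OF eqs' dvd_refl])
      qed
    next
      assume "\<exists>l. prime_elem l \<and> l dvd G \<and> \<not> l\<^sup>2 dvd G"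
      then obtain l where l: "prime_elem l" "l dvd G" "\<not> l\<^sup>2 dvd G" by blast
      have "\<not> (l dvd a \<and> l dvd c)"
        using l(3) eqs(1) by (auto simp: power2_eq_square mult_dvd_mono)
      moreover have "l dvd a \<or> l dvd c"
        using l(1,2) eqs(1) by (auto simp: prime_elem_dvd_mult_iff)
      moreover have "\<not> l dvd 1" using l(1) by (auto simp: prime_elem_def)
      moreover have "l dvd x" if "l dvd x * y" "\<not> l dvd y" for x y
        using that l(1) by (auto simp: prime_elem_dvd_mult_iff)
      ultimately show False
        using no_linear[OF eqs, of l] no_linear[OF eqs', of l] by blast
    qed
  qed
qed

text \<open>
  For a monomial the order of vanishing at 0 equals the degree. Both are additive and the first
  never exceeds the second, so equality is inherited by factors.
\<close>

lemma monom_factorE: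
  fixes p :: "'a::idom poly"
  assumes "p dvd Polynomial.monom c k" and "c \<noteq> 0"
  obtains a i where "p = Polynomial.monom a i"
proof -
  obtain q where pq: "Polynomial.monom c k = p * q" using assms(1) by (rule dvdE)
  have nz: "p * q \<noteq> 0" using pq assms(2) by (metis monom_eq_0_iff)
  have "[:- 0, 1:] ^ k dvd p * q"
    unfolding pq[symmetric] by (simp add: monom_altdef dvd_smult)
  then have "k \<le> order 0 p + order 0 q"
    using order_mult[OF nz] nz by (simp only: order_divides) simp
  moreover have "Polynomial.degree p + Polynomial.degree q = k"
    using nz assms(2) by (metis degree_mult_eq degree_monom_eq mult_eq_0_iff pq)
  moreover have "order 0 p \<le> Polynomial.degree p" "order 0 q \<le> Polynomial.degree q"
    using nz by (auto intro: order_degree)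
  ultimately have deg: "Polynomial.degree p = order 0 p" by linarith
  obtain r where r: "p = [:- 0, 1:] ^ order 0 p * r"
    using order_1[of 0 p] by (auto elim: dvdE)
  have "Polynomial.degree p = order 0 p + Polynomial.degree r"
    using nz r by (metis degree_mult_eq degree_linear_power mult_eq_0_iff neg_equal_zero)
  then have "Polynomial.degree r = 0" using deg by simp
  then obtain a where "r = [:a:]" by (rule degree_eq_zeroE)
  then have "p = Polynomial.monom a (order 0 p)"
    using r by (simp add: monom_altdef)
  then show ?thesis by (rule that)
qed

section \<open>Homogeneous polynomials\<close>

definition eval0 :: "('v, 'a::comm_ring_1) mpoly \<Rightarrow> 'a" where
  "eval0 = subst (\<lambda>c. c) (\<lambda>_. 0)"

text \<open>
  The polynomial \<open>p(t d)\<close> in a new variable \<open>t\<close>, every variable \<open>d\<close> being multiplied by \<open>t\<close>. Thus \<open>p\<close> is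
  homogeneous iff its image is a monomial in \<open>t\<close>, and this is the form in which homogeneity is
  used here.
\<close>

definition scale :: "('v, 'a::comm_ring_1) mpoly \<Rightarrow> ('v, 'a) mpoly poly" where
  "scale = subst (\<lambda>c. [:const c:]) (\<lambda>v. Polynomial.monom (mvar v) 1)"

lemma const_0: "const 0 = 0"
  by (simp add: const_def)

lemma const_eq_0_iff [simp]: "const c = 0 \<longleftrightarrow> c = 0"
  using injD[OF inj_single, of 0 c 0] by (auto simp: const_def)

lemma comm_ring_hom_pCons_const: "comm_ring_hom (\<lambda>c. [:const c:])"
  by (rule comm_ring_hom_comp[OF comm_ring_hom_pCons comm_ring_hom_const])

lemma comm_ring_hom_eval0: "comm_ring_hom eval0"
  unfolding eval0_def by (rule comm_ring_hom.comm_ring_hom_subst[OF comm_ring_hom_id])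

lemma comm_ring_hom_scale: "comm_ring_hom scale"
  unfolding scale_def by (rule comm_ring_hom.comm_ring_hom_subst[OF comm_ring_hom_pCons_const])

lemmas eval0_simps =
  comm_ring_hom.subst_const[OF comm_ring_hom_id, of "\<lambda>_. 0", folded eval0_def]
  comm_ring_hom.subst_mvar[OF comm_ring_hom_id, of "\<lambda>_. 0", folded eval0_def]

lemmas scale_simps =
  comm_ring_hom.subst_const[OF comm_ring_hom_pCons_const, of "\<lambda>v. Polynomial.monom (mvar v) 1", folded scale_def]
  comm_ring_hom.subst_mvar[OF comm_ring_hom_pCons_const, of "\<lambda>v. Polynomial.monom (mvar v) 1", folded scale_def]

lemma poly_scale_1: "poly (scale p) 1 = p"
  by (rule hom_mpoly_eqI[OF comm_ring_hom_comp[OF comm_ring_hom_poly comm_ring_hom_scale] comm_ring_hom_id])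
     (simp_all add: scale_simps poly_monom)

lemma poly_scale_0: "poly (scale p) 0 = const (eval0 p)"
  by (rule hom_mpoly_eqI[OF comm_ring_hom_comp[OF comm_ring_hom_poly comm_ring_hom_scale]
        comm_ring_hom_comp[OF comm_ring_hom_const comm_ring_hom_eval0]])
     (simp_all add: scale_simps eval0_simps poly_monom const_0)

text \<open>
  The hypothesis makes \<open>p\<close> homogeneous, as a divisor of a monomial is a monomial; a homogeneous
  polynomial with a nonzero constant term has degree 0.
\<close>

lemma homogeneous_unit:
  fixes p :: "('v::linorder, 'a::field) mpoly"
  assumes "scale p dvd Polynomial.monom c k" "c \<noteq> 0" and "eval0 p \<noteq> 0"
  shows "p = const (eval0 p)"
proof -
  obtain a i where ai: "scale p = Polynomial.monom a i"
    using assms(1,2) by (rule monom_factorE)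
  have "i = 0"
    using poly_scale_0[of p] assms(3) by (auto simp: ai poly_monom const_0 power_0_left split: if_splits)
  then show ?thesis using poly_scale_0[of p] poly_scale_1[of p] by (simp add: ai poly_monom)
qed

lemma const_dvd_one: "const c dvd 1" if "c \<noteq> (0 :: 'a::field)"
  by (rule hom_dvd_one[OF comm_ring_hom_const]) (use that in \<open>simp add: dvd_field_iff\<close>)

text \<open>
  A unit divides the monomial 1, so it is homogeneous.
\<close>

lemma mpoly_unit_is_const:
  fixes p :: "('v::linorder, 'a::field) mpoly"
  assumes "p dvd 1"
  shows "p = const (eval0 p)"
proof (rule homogeneous_unit)
  show "scale p dvd Polynomial.monom 1 0"
    using hom_dvd_one[OF comm_ring_hom_scale assms] by simp
  show "eval0 p \<noteq> 0"
    using hom_dvd_one[OF comm_ring_hom_eval0 assms] by auto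
qed simp

text \<open>
  Irreducibility can be lost or gained under specialization, but for homogeneous polynomials it
  lifts: the factors of \<open>G\<close> are homogeneous, and if the image of one of them is a unit, then the
  evaluation \<open>e\<close>, which recovers the constant term, shows that its constant term is nonzero. The
  factor is then a constant.
\<close>

lemma irreducible_if_specialization_irreducible:
  fixes G :: "('v::linorder, 'a::field) mpoly" and h :: "('v, 'a) mpoly \<Rightarrow> 'b::comm_ring_1"
  assumes homog: "scale G dvd Polynomial.monom c k" "c \<noteq> 0"
    and "comm_ring_hom h" and "comm_ring_hom e" and eh: "\<And>p. e (h p) = eval0 p"
    and irr: "Factorial_Ring.irreducible (h G)"
  shows "Factorial_Ring.irreducible G"
proof (rule Factorial_Ring.irreducibleI)
  interpret h: comm_ring_hom h by fact
  interpret s: comm_ring_hom "scale :: ('v, 'a) mpoly \<Rightarrow> _" by (rule comm_ring_hom_scale)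
  show "G \<noteq> 0" using irr by (auto simp: Factorial_Ring.irreducible_def)
  show "\<not> G dvd 1"
    using irr hom_dvd_one[OF \<open>comm_ring_hom h\<close>] by (auto simp: Factorial_Ring.irreducible_def)
  have unit: "p dvd 1" if "p dvd G" "h p dvd 1" for p
  proof -
    have "scale p dvd scale G" using that(1) by (auto simp: s.hom_mult)
    then have "scale p dvd Polynomial.monom c k" using homog(1) by (rule dvd_trans)
    moreover have "eval0 p \<noteq> 0"
      using hom_dvd_one[OF \<open>comm_ring_hom e\<close> that(2)] by (auto simp: eh)
    ultimately show ?thesis
      using homogeneous_unit[of p c k] homog(2) const_dvd_one by metis
  qed
  show "p dvd 1 \<or> q dvd 1" if "G = p * q" for p q
  proof -
    have "h p dvd 1 \<or> h q dvd 1"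
      using irr that by (auto simp: Factorial_Ring.irreducible_def h.hom_mult)
    then show ?thesis using unit that by auto
  qed
qed


section \<open>Bordered determinants\<close>

text \<open>
  The Cayley-Menger matrix of \<open>n\<close> points with arbitrary entries \<open>d i j\<close> in place of the squared
  distances; one index more than \<open>n\<close> because of the border.
\<close>

definition bordered :: "nat \<Rightarrow> (nat \<Rightarrow> nat \<Rightarrow> 'a) \<Rightarrow> 'a::comm_ring_1 mat" where
  "bordered n d = mat (n + 1) (n + 1) (\<lambda>(r, c).
     if r = 0 \<and> c = 0 then 0 else if r = 0 \<or> c = 0 then 1 else d (r - 1) (c - 1))"

definition unbordered :: "nat \<Rightarrow> (nat \<Rightarrow> nat \<Rightarrow> 'a) \<Rightarrow> 'a::comm_ring_1 mat" where
  "unbordered n d = mat n n (\<lambda>(r, c). d r c)"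

lemma bordered_carrier [simp]: "bordered n d \<in> carrier_mat (n + 1) (n + 1)"
  by (simp add: bordered_def)

lemma unbordered_carrier [simp]: "unbordered n d \<in> carrier_mat n n"
  by (simp add: unbordered_def)

lemma bordered_dims [simp]: "dim_row (bordered n d) = Suc n" "dim_col (bordered n d) = Suc n"
  by (simp_all add: bordered_def)

lemma bordered_index:
  "bordered n d $$ (0, 0) = 0"
  "c < n \<Longrightarrow> bordered n d $$ (0, Suc c) = 1"
  "r < n \<Longrightarrow> bordered n d $$ (Suc r, 0) = 1"
  "r < n \<Longrightarrow> c < n \<Longrightarrow> bordered n d $$ (Suc r, Suc c) = d r c"
  by (simp_all add: bordered_def)

lemma (in comm_ring_hom) det_bordered_hom:
  "hom (det (bordered n d)) = det (bordered n (\<lambda>i j. hom (d i j)))"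
proof -
  have "map_mat hom (bordered n d) = bordered n (\<lambda>i j. hom (d i j))"
    by (rule eq_matI) (auto simp: bordered_def)
  then show ?thesis by (metis hom_det)
qed

lemma (in comm_ring_hom) det_unbordered_hom:
  "hom (det (unbordered n d)) = det (unbordered n (\<lambda>i j. hom (d i j)))"
proof -
  have "map_mat hom (unbordered n d) = unbordered n (\<lambda>i j. hom (d i j))"
    by (rule eq_matI) (auto simp: unbordered_def)
  then show ?thesis by (metis hom_det)
qed

lemma bordered_cong:
  assumes "\<And>i j. i < n \<Longrightarrow> j < n \<Longrightarrow> d i j = d' i j"
  shows "bordered n d = bordered n d'"
  by (rule eq_matI) (use assms in \<open>auto simp: bordered_def\<close>)

lemma unbordered_cong:
  assumes "\<And>i j. i < n \<Longrightarrow> j < n \<Longrightarrow> d i j = d' i j"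
  shows "unbordered n d = unbordered n d'"
  by (rule eq_matI) (use assms in \<open>auto simp: unbordered_def\<close>)

text \<open>
  The last point has the same squared distance \<open>s\<close> from all the others. Subtracting \<open>s\<close> times the
  border from the last row and column leaves there only the entry 1 in the border and \<open>- 2 s\<close> on
  the diagonal, and the determinant is expanded along them.
\<close>

lemma det_bordered_apex:
  fixes d :: "nat \<Rightarrow> nat \<Rightarrow> 'a::comm_ring_1"
  assumes d: "\<And>i. i < n \<Longrightarrow> d i n = s" "\<And>i. i < n \<Longrightarrow> d n i = s" "d n n = 0"
  shows "det (bordered (n + 1) d) = - 2 * s * det (bordered n d) - det (unbordered n d)"
proof -
  define A where "A = addcol (- s) (n + 1) 0 (addrow (- s) (n + 1) 0 (bordered (n + 1) d))"
  have A_carrier: "A \<in> carrier_mat (n + 2) (n + 2)"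
    by (simp add: A_def bordered_def mat_addcol_def mat_addrow_gen_def)
  have entry: "A $$ (r, c) =
      (if r = n + 1 \<and> c = n + 1 then - 2 * s
       else if r = n + 1 then (if c = 0 then 1 else 0)
       else if c = n + 1 then (if r = 0 then 1 else 0)
       else bordered n d $$ (r, c))" if "r < n + 2" "c < n + 2" for r c
  proof -
    let ?e = "\<lambda>r c. bordered (n + 1) d $$ (r, c)"
    let ?f = "\<lambda>c. if r = n + 1 then - s * ?e 0 c + ?e r c else ?e r c"
    have "A $$ (r, c) = (if c = n + 1 then - s * ?f 0 + ?f c else ?f c)"
      using that by (auto simp: A_def mat_addcol_def mat_addrow_gen_def)
    then show ?thesis
      using that d by (cases r; cases c) (auto simp: bordered_index less_Suc_eq)
  qed
  have "det (bordered (n + 1) d) = det A"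
    using bordered_carrier[of "n + 1" d] unfolding A_def
    by (subst det_addcol[where n = "n + 2"]; (subst det_addrow[where n = "n + 2"])?) auto
  also have "\<dots> = (\<Sum>j<n + 2. A $$ (n + 1, j) * cofactor A (n + 1) j)"
    by (rule laplace_expansion_row[OF A_carrier]) simp
  also have "\<dots> = (\<Sum>j\<in>{0, n + 1}. A $$ (n + 1, j) * cofactor A (n + 1) j)"
    by (rule sum.mono_neutral_right) (auto simp: entry)
  also have "\<dots> = cofactor A (n + 1) 0 - 2 * s * cofactor A (n + 1) (n + 1)"
    by (simp add: entry)
  also have "cofactor A (n + 1) (n + 1) = det (bordered n d)"
  proof -
    have "mat_delete A (n + 1) (n + 1) = bordered n d"
      by (rule eq_matI) (use A_carrier in \<open>auto simp: mat_delete_def entry bordered_def\<close>)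
    then show ?thesis by (simp add: cofactor_def flip: power_add)
  qed
  also have "cofactor A (n + 1) 0 = - det (unbordered n d)"
  proof -
    define B where "B = mat_delete A (n + 1) 0"
    have B_carrier: "B \<in> carrier_mat (n + 1) (n + 1)"
      using A_carrier by (simp add: B_def mat_delete_def)
    have B_last: "B $$ (r, n) = (if r = 0 then 1 else 0)" if "r < n + 1" for r
      using A_carrier that by (simp add: B_def mat_delete_def entry)
    have "det B = (\<Sum>r<n + 1. B $$ (r, n) * cofactor B r n)"
      by (rule laplace_expansion_column[OF B_carrier]) simp
    also have "\<dots> = (\<Sum>r\<in>{0}. B $$ (r, n) * cofactor B r n)"
      by (rule sum.mono_neutral_right) (auto simp: B_last)
    also have "\<dots> = cofactor B 0 n"
      by (simp add: B_last)
    also have "mat_delete B 0 n = unbordered n d"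
      by (rule eq_matI)
         (use A_carrier in \<open>auto simp: B_def mat_delete_def entry bordered_def unbordered_def\<close>)
    then have "cofactor B 0 n = (- 1) ^ n * det (unbordered n d)"
      by (simp add: cofactor_def)
    finally have "det B = (- 1) ^ n * det (unbordered n d)" .
    then show ?thesis
      by (simp add: cofactor_def B_def mult.assoc[symmetric] flip: power_add mult_2)
  qed
  finally show ?thesis by simp
qed

text \<open>
  Multiplying the column 0 by \<open>t\<close> makes all rows but the first divisible by \<open>t\<close>.
\<close>

lemma det_bordered_scale:
  "t * det (bordered n (\<lambda>i j. t * d i j)) = t ^ n * det (bordered n d)"
proof -
  define D where "D a b = mat (n + 1) (n + 1) (\<lambda>(r, c). if r = c then if r = 0 then a else b else 0)"
    for a b :: 'a
  have D_carrier: "D a b \<in> carrier_mat (n + 1) (n + 1)" for a b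
    by (simp add: D_def)
  have det_D: "det (D a b) = a * b ^ n" for a b
  proof -
    have "det (D a b) = prod_list (diag_mat (D a b))"
      by (rule det_upper_triangular[OF _ D_carrier]) (auto simp: D_def upper_triangular_def)
    also have "diag_mat (D a b) = a # map (\<lambda>_. b) [0..<n]"
      by (auto simp: D_def diag_mat_def map_Suc_upt[symmetric] upt_conv_Cons simp del: upt_Suc)
    also have "prod_list \<dots> = a * b ^ n"
    proof -
      have "prod_list (map (\<lambda>_. b) [0..<k]) = b ^ k" for k
        by (induction k) (simp_all add: mult.commute)
      then show ?thesis by simp
    qed
    finally show ?thesis .
  qed
  have "bordered n (\<lambda>i j. t * d i j) * D t 1 = D 1 t * bordered n d"
    (is "?A * _ = _ * ?B")
  proof (rule eq_matI)
    fix r c assume "r < dim_row (D 1 t * ?B)" "c < dim_col (D 1 t * ?B)"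
    then have r: "r < n + 1" and c: "c < n + 1" by (simp_all add: D_def bordered_def)
    have "(?A * D t 1) $$ (r, c) = (\<Sum>k = 0..<n + 1. ?A $$ (r, k) * D t 1 $$ (k, c))"
      using r c by (simp add: scalar_prod_def D_def bordered_def)
    also have "\<dots> = (\<Sum>k = 0..<n + 1. if k = c then ?A $$ (r, c) * D t 1 $$ (c, c) else 0)"
      by (rule sum.cong) (use c in \<open>auto simp: D_def\<close>)
    also have "\<dots> = ?A $$ (r, c) * D t 1 $$ (c, c)"
      using c by (subst sum.delta) auto
    also have "\<dots> = D 1 t $$ (r, r) * ?B $$ (r, c)"
      using r c by (simp add: D_def bordered_def)
    also have "\<dots> = (\<Sum>k = 0..<n + 1. if k = r then D 1 t $$ (r, r) * ?B $$ (r, c) else 0)"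
      using r by (subst sum.delta) auto
    also have "\<dots> = (\<Sum>k = 0..<n + 1. D 1 t $$ (r, k) * ?B $$ (k, c))"
      by (rule sum.cong) (use r in \<open>auto simp: D_def\<close>)
    also have "\<dots> = (D 1 t * ?B) $$ (r, c)"
      using r c by (simp add: scalar_prod_def D_def bordered_def)
    finally show "(?A * D t 1) $$ (r, c) = (D 1 t * ?B) $$ (r, c)" .
  qed (simp_all add: D_def bordered_def)
  then have "det ?A * det (D t 1) = det (D 1 t) * det ?B"
    by (metis det_mult bordered_carrier D_carrier)
  then show ?thesis by (simp add: det_D mult_ac)
qed

text \<open>
  The first \<open>m\<close> points form a regular simplex of edge 1 and \<open>s = (m - 1) / (2 m)\<close> is the square of
  its circumradius, so the last point can be taken to be the circumcentre. The affine dependency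
  \<open>m c = p\<^sub>0 + \<dots> + p\<^sub>m\<^sub>-\<^sub>1\<close> yields the kernel vector of the bordered matrix. The other
  matrix has a trivial kernel because \<open>s\<close> is nonzero.
\<close>

lemma simplex_with_circumcentre:
  fixes m :: nat and s :: "'a::field_char_0"
  defines "d \<equiv> \<lambda>i j. if i = j then 0 else if i = m \<or> j = m then s else 1"
  assumes m: "m \<ge> 2" and s: "2 * of_nat m * s = of_nat m - 1"
  shows "det (bordered (m + 1) d) = 0" and "det (unbordered (m + 1) d) \<noteq> 0"
proof -
  have m0: "of_nat m \<noteq> (0::'a)" "of_nat m - 1 \<noteq> (0::'a)"
    using m by (auto simp: of_nat_eq_1_iff[where ?'a='a])
  then have s0: "s \<noteq> 0" using s by auto
  \<comment> \<open>The entry for the border is determined by the row of the last point.\<close>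
  define v where "v = vec (m + 2) (\<lambda>i. if i = 0 then - of_nat m * s else if i \<le> m then 1 else - of_nat m)"
  have sum_split: "(\<Sum>i = 0..<m + 2. f i) = f 0 + (\<Sum>i<m. f (i + 1)) + f (m + 1)"
    for f :: "nat \<Rightarrow> 'a"
  proof -
    have "(\<Sum>i = 0..<m + 2. f i) = (\<Sum>i = 0..<Suc (m + 1). f i)" by simp
    also have "\<dots> = f 0 + (\<Sum>i = 0..<m + 1. f (Suc i))"
      by (subst sum.atLeast0_lessThan_Suc_shift) simp
    finally show ?thesis by (simp add: lessThan_atLeast0)
  qed
  have off_diag: "(\<Sum>j<m. if i = j then 0 else 1) = of_nat m - (1::'a)" if "i < m" for i
  proof -
    have "(\<Sum>j<m. if i = j then 0 else 1) = (\<Sum>j<m. 1 - (if i = j then 1 else (0::'a)))"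
      by (rule sum.cong) auto
    then show ?thesis using that by (simp add: sum_subtractf)
  qed
  have "bordered (m + 1) d *\<^sub>v v = 0\<^sub>v (m + 2)"
  proof (rule eq_vecI)
    fix r assume "r < dim_vec (0\<^sub>v (m + 2) :: 'a vec)"
    then have r: "r < m + 2" by simp
    then have eq: "(bordered (m + 1) d *\<^sub>v v) $ r
        = bordered (m + 1) d $$ (r, 0) * (- of_nat m * s)
        + (\<Sum>j<m. bordered (m + 1) d $$ (r, j + 1))
        + bordered (m + 1) d $$ (r, m + 1) * (- of_nat m)"
    proof -
      have "(bordered (m + 1) d *\<^sub>v v) $ r = (\<Sum>k = 0..<m + 2. bordered (m + 1) d $$ (r, k) * v $ k)"
        using r by (simp add: scalar_prod_def v_def del: sum.op_ivl_Suc)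
      then show ?thesis by (simp only: sum_split) (simp add: v_def)
    qed
    consider "r = 0" | i where "r = i + 1" "i < m" | "r = m + 1"
      using r by (metis Suc_eq_plus1 add_2_eq_Suc' less_Suc_eq not0_implies_Suc Suc_less_eq)
    then have "(bordered (m + 1) d *\<^sub>v v) $ r = 0"
    proof cases
      case 2
      then have sum_r: "(\<Sum>j<m. bordered (m + 1) d $$ (r, j + 1)) = (\<Sum>j<m. if i = j then 0 else 1)"
        by (intro sum.cong) (auto simp: bordered_index d_def)
      show ?thesis unfolding eq sum_r off_diag[OF 2(2)] using 2 s
        by (simp add: bordered_index d_def algebra_simps)
    qed (unfold eq, simp_all add: bordered_def d_def)
    then show "(bordered (m + 1) d *\<^sub>v v) $ r = 0\<^sub>v (m + 2) $ r" using r by simp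
  qed (simp add: bordered_def)
  moreover have "v \<in> carrier_vec (m + 2)" by (simp add: v_def)
  moreover have "v \<noteq> 0\<^sub>v (m + 2)"
  proof
    assume "v = 0\<^sub>v (m + 2)"
    then have "v $ (m + 1) = 0" by simp
    then show False using m0 by (simp add: v_def)
  qed
  ultimately show "det (bordered (m + 1) d) = 0"
    using det_0_iff_vec_prod_zero[of "bordered (m + 1) d" "m + 2"] by (auto simp: bordered_def)
  show "det (unbordered (m + 1) d) \<noteq> 0"
  proof
    assume "det (unbordered (m + 1) d) = 0"
    then obtain w where w: "w \<in> carrier_vec (m + 1)" "w \<noteq> 0\<^sub>v (m + 1)"
      "unbordered (m + 1) d *\<^sub>v w = 0\<^sub>v (m + 1)"
      using det_0_iff_vec_prod_zero[of "unbordered (m + 1) d" "m + 1"] by auto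
    define S where "S = (\<Sum>j<m. w $ j)"
    have row: "(\<Sum>j<m. d i j * w $ j) + d i m * w $ m = 0" if "i < m + 1" for i
    proof -
      have "(unbordered (m + 1) d *\<^sub>v w) $ i = 0" using w(3) that by simp
      then show ?thesis using w(1) that
        by (simp add: scalar_prod_def unbordered_def lessThan_atLeast0)
    qed
    have "(\<Sum>j<m. d m j * w $ j) = s * S"
      unfolding S_def sum_distrib_left by (rule sum.cong) (auto simp: d_def)
    then have S0: "S = 0" using row[of m] s0 by (simp add: d_def)
    have wi: "w $ i = s * w $ m" if "i < m" for i
    proof -
      have "(\<Sum>j<m. d i j * w $ j) = (\<Sum>j<m. w $ j - (if j = i then w $ i else 0))"
        using that by (intro sum.cong) (auto simp: d_def)
      also have "\<dots> = S - w $ i"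
        using that by (simp add: sum_subtractf S_def)
      finally show ?thesis using row[of i] that S0 by (simp add: d_def algebra_simps)
    qed
    have "S = of_nat m * (s * w $ m)" unfolding S_def by (simp add: wi)
    then have wm: "w $ m = 0" using S0 s0 m0 by simp
    have "w = 0\<^sub>v (m + 1)"
      by (rule eq_vecI) (use w(1) wm wi in \<open>auto simp: less_Suc_eq\<close>)
    then show False using w(2) by simp
  qed
qed


section \<open>Equidistant apex\<close>

definition dist_sq :: "nat \<Rightarrow> nat \<Rightarrow> (nat \<times> nat, 'a::comm_ring_1) mpoly" where
  "dist_sq i j = (if i = j then 0 else (dvar i j)\<^sup>2)"

definition dist_det :: "nat \<Rightarrow> (nat \<times> nat, 'a::comm_ring_1) mpoly" where
  "dist_det n = det (unbordered (n + 1) dist_sq)"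

lemma cayley_menger_eq:
  "(cayley_menger n :: (nat \<times> nat, 'a::comm_ring_1) mpoly) = det (bordered (n + 1) dist_sq)"
proof -
  have "(CM n :: (nat \<times> nat, 'a) mpoly mat) = bordered (n + 1) dist_sq"
    by (rule eq_matI) (auto simp: CM_def bordered_def dist_sq_def)
  then show ?thesis by (simp add: cayley_menger_def)
qed

text \<open>
  This is the homogeneity of the Cayley-Menger determinant: the image is \<open>t ^ (2 * n)\<close> times the
  determinant. The divisibility avoids cancelling the extra factor \<open>t\<^sup>2\<close>.
\<close>

lemma scale_cayley_menger_dvd:
  "scale (cayley_menger n :: (nat \<times> nat, 'a::comm_ring_1) mpoly)
    dvd Polynomial.monom (cayley_menger n) (2 * (n + 1))"
proof -
  interpret s: comm_ring_hom "scale :: (nat \<times> nat, 'a) mpoly \<Rightarrow> _" by (rule comm_ring_hom_scale)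
  interpret c: comm_ring_hom "\<lambda>p :: (nat \<times> nat, 'a) mpoly. [:p:]" by (rule comm_ring_hom_pCons)
  let ?t = "Polynomial.monom 1 2 :: (nat \<times> nat, 'a) mpoly poly"
  have entry: "scale (dist_sq i j) = ?t * [:dist_sq i j :: (nat \<times> nat, 'a) mpoly:]" for i j
    by (simp add: dist_sq_def dvar_def s.hom_power scale_simps monom_power smult_monom mult.commute)
  have "?t * scale (cayley_menger n) = ?t ^ (n + 1) * [:cayley_menger n:]"
    unfolding cayley_menger_eq s.det_bordered_hom c.det_bordered_hom entry
    by (rule det_bordered_scale)
  also have "\<dots> = Polynomial.monom (cayley_menger n) (2 * (n + 1))"
    by (simp add: monom_power mult_monom smult_monom mult.commute)
  finally show ?thesis by (metis dvd_triv_right)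
qed

text \<open>
  The specialization that makes the point \<open>n\<close> equidistant from the points before it: the variables
  \<open>d\<^sub>i\<^sub>n\<close> are all replaced by one new variable, and the result is a univariate polynomial over the
  old ring.
\<close>

definition equidistant_apex :: "nat \<Rightarrow> (nat \<times> nat, 'a::comm_ring_1) mpoly \<Rightarrow> (nat \<times> nat, 'a) mpoly poly" where
  "equidistant_apex n = subst (\<lambda>c. [:const c:]) (\<lambda>(i, j). if j = n then [:0, 1:] else [:mvar (i, j):])"

lemma comm_ring_hom_equidistant_apex: "comm_ring_hom (equidistant_apex n)"
  unfolding equidistant_apex_def by (rule comm_ring_hom.comm_ring_hom_subst[OF comm_ring_hom_pCons_const])

lemma equidistant_apex_mvar: "equidistant_apex n (mvar (i, j)) = (if j = n then [:0, 1:] else [:mvar (i, j):])"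
  by (simp add: equidistant_apex_def comm_ring_hom.subst_mvar[OF comm_ring_hom_pCons_const])

lemma equidistant_apex_const: "equidistant_apex n (const c) = [:const c:]"
  by (simp add: equidistant_apex_def comm_ring_hom.subst_const[OF comm_ring_hom_pCons_const])

lemma eval0_0: "eval0 0 = 0"
  using eval0_simps(1)[of 0] by (simp add: const_0)

lemma eval0_equidistant_apex: "eval0 (poly (equidistant_apex n p) 0) = eval0 p"
  by (rule hom_mpoly_eqI[OF comm_ring_hom_comp[OF comm_ring_hom_eval0
        comm_ring_hom_comp[OF comm_ring_hom_poly comm_ring_hom_equidistant_apex]] comm_ring_hom_eval0])
     (auto simp: equidistant_apex_const equidistant_apex_mvar eval0_simps eval0_0)

lemma equidistant_apex_cayley_menger:
  "equidistant_apex (Suc n) (cayley_menger (Suc n)) = [:- dist_det n, 0, - 2 * cayley_menger n:]"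
proof -
  let ?h = "equidistant_apex (Suc n) :: (nat \<times> nat, 'a) mpoly \<Rightarrow> _"
  interpret h: comm_ring_hom ?h by (rule comm_ring_hom_equidistant_apex)
  interpret c: comm_ring_hom "\<lambda>p :: (nat \<times> nat, 'a) mpoly. [:p:]" by (rule comm_ring_hom_pCons)
  have apex: "?h (dist_sq i (Suc n)) = [:0, 0, 1:]" "?h (dist_sq (Suc n) i) = [:0, 0, 1:]"
    if "i < Suc n" for i
    using that by (auto simp: dist_sq_def dvar_def h.hom_power equidistant_apex_mvar)
      (simp_all add: power2_eq_square)
  have base: "?h (dist_sq i j) = [:dist_sq i j:]" if "i < Suc n" "j < Suc n" for i j
    using that by (auto simp: dist_sq_def dvar_def h.hom_power c.hom_power equidistant_apex_mvar max_def)
  have "?h (cayley_menger (Suc n)) = det (bordered (Suc n + 1) (\<lambda>i j. ?h (dist_sq i j)))"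
    unfolding cayley_menger_eq by (rule h.det_bordered_hom)
  also have "\<dots> = - 2 * [:0, 0, 1:] * det (bordered (Suc n) (\<lambda>i j. ?h (dist_sq i j)))
      - det (unbordered (Suc n) (\<lambda>i j. ?h (dist_sq i j)))"
    by (rule det_bordered_apex) (auto simp: apex, simp add: dist_sq_def)
  also have "bordered (Suc n) (\<lambda>i j. ?h (dist_sq i j)) = bordered (Suc n) (\<lambda>i j. [:dist_sq i j:])"
    by (rule bordered_cong) (rule base)
  also have "unbordered (Suc n) (\<lambda>i j. ?h (dist_sq i j)) = unbordered (Suc n) (\<lambda>i j. [:dist_sq i j:])"
    by (rule unbordered_cong) (rule base)
  also have "det (bordered (Suc n) (\<lambda>i j. [:dist_sq i j :: (nat \<times> nat, 'a) mpoly:])) = [:cayley_menger n:]"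
    unfolding cayley_menger_eq Suc_eq_plus1 by (rule c.det_bordered_hom[symmetric])
  also have "det (unbordered (Suc n) (\<lambda>i j. [:dist_sq i j :: (nat \<times> nat, 'a) mpoly:])) = [:dist_det n:]"
    unfolding dist_det_def Suc_eq_plus1 by (rule c.det_unbordered_hom[symmetric])
  also have "- 2 * [:0, 0, 1:] * [:cayley_menger n:] - [:dist_det n :: (nat \<times> nat, 'a) mpoly:]
      = [:- dist_det n, 0, - 2 * cayley_menger n:]"
  proof -
    have two: "(2 :: (nat \<times> nat, 'a) mpoly poly) = [:2:]" by (simp add: numeral_poly)
    show ?thesis unfolding two by simp
  qed
  finally show ?thesis .
qed

lemma irreducible_cayley_menger_SucI:
  fixes n :: nat
  defines "G \<equiv> - 2 * (cayley_menger n :: (nat \<times> nat, 'a::field_char_0) mpoly)"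
  assumes "G \<noteq> 0" and "\<And>u. u dvd G \<Longrightarrow> u dvd - dist_det n \<Longrightarrow> u dvd 1"
    and "Factorial_Ring.irreducible G \<or> (\<exists>l. prime_elem l \<and> l dvd G \<and> \<not> l\<^sup>2 dvd G)"
  shows "Factorial_Ring.irreducible (cayley_menger (Suc n) :: (nat \<times> nat, 'a) mpoly)"
proof (rule irreducible_if_specialization_irreducible)
  have irr: "Factorial_Ring.irreducible (equidistant_apex (Suc n) (cayley_menger (Suc n) :: (nat \<times> nat, 'a) mpoly))"
    unfolding equidistant_apex_cayley_menger G_def[symmetric] by (rule irreducible_quadratic[OF assms(2-4)])
  then show "Factorial_Ring.irreducible (equidistant_apex (Suc n) (cayley_menger (Suc n) :: (nat \<times> nat, 'a) mpoly))" .
  interpret h: comm_ring_hom "equidistant_apex (Suc n) :: (nat \<times> nat, 'a) mpoly \<Rightarrow> _"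
    by (rule comm_ring_hom_equidistant_apex)
  show "(cayley_menger (Suc n) :: (nat \<times> nat, 'a) mpoly) \<noteq> 0"
    using irr by (metis h.hom_zero Factorial_Ring.not_irreducible_zero)
  show "scale (cayley_menger (Suc n)) dvd Polynomial.monom (cayley_menger (Suc n)) (2 * (Suc n + 1))"
    by (rule scale_cayley_menger_dvd)
  show "comm_ring_hom (equidistant_apex (Suc n))" by (rule comm_ring_hom_equidistant_apex)
  show "comm_ring_hom (\<lambda>q. eval0 (poly q 0))"
    by (rule comm_ring_hom_comp[OF comm_ring_hom_eval0 comm_ring_hom_poly])
qed (rule eval0_equidistant_apex)

lemma hom_cayley_menger:
  assumes "comm_ring_hom h" and "\<And>i j. i \<le> n \<Longrightarrow> j \<le> n \<Longrightarrow> h (dist_sq i j) = d i j"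
  shows "h (cayley_menger n) = det (bordered (n + 1) d)"
    and "h (dist_det n) = det (unbordered (n + 1) d)"
proof -
  interpret h: comm_ring_hom h by fact
  show "h (cayley_menger n) = det (bordered (n + 1) d)"
    unfolding cayley_menger_eq h.det_bordered_hom
    by (rule arg_cong[where f = det], rule bordered_cong) (use assms in auto)
  show "h (dist_det n) = det (unbordered (n + 1) d)"
    unfolding dist_det_def h.det_unbordered_hom
    by (rule arg_cong[where f = det], rule unbordered_cong) (use assms in auto)
qed

text \<open>
  Witnessed by a point where the first determinant vanishes and the second does not: a regular
  simplex together with its circumcentre.
\<close>

lemma cayley_menger_not_dvd_dist_det:
  assumes "n \<ge> 2"
  shows "\<not> (cayley_menger n :: (nat \<times> nat, complex) mpoly) dvd dist_det n"
proof
  define s :: complex where "s = (of_nat n - 1) / (2 * of_nat n)"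
  define h :: "(nat \<times> nat, complex) mpoly \<Rightarrow> complex" where "h = subst (\<lambda>c. c) (\<lambda>(i, j). if j = n then csqrt s else 1)"
  have h: "comm_ring_hom h"
    unfolding h_def by (rule comm_ring_hom.comm_ring_hom_subst[OF comm_ring_hom_id])
  interpret h: comm_ring_hom h by fact
  have h_mvar: "h (mvar (i, j)) = (if j = n then csqrt s else 1)" for i j
    by (simp add: h_def comm_ring_hom.subst_mvar[OF comm_ring_hom_id])
  have dist: "h (dist_sq i j) = (if i = j then 0 else if i = n \<or> j = n then s else 1)"
    if "i \<le> n" "j \<le> n" for i j
    using that by (auto simp: dist_sq_def dvar_def h_mvar h.hom_power max_def)
  have s: "2 * of_nat n * s = of_nat n - 1"
    using assms by (simp add: s_def)
  assume "(cayley_menger n :: (nat \<times> nat, complex) mpoly) dvd dist_det n"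
  then have "h (cayley_menger n) dvd h (dist_det n)"
    by (auto simp: h.hom_mult)
  moreover have "h (cayley_menger n)
      = det (bordered (n + 1) (\<lambda>i j. if i = j then 0 else if i = n \<or> j = n then s else 1))"
    by (rule hom_cayley_menger(1)[OF h]) (rule dist)
  moreover have "h (dist_det n)
      = det (unbordered (n + 1) (\<lambda>i j. if i = j then 0 else if i = n \<or> j = n then s else 1))"
    by (rule hom_cayley_menger(2)[OF h]) (rule dist)
  ultimately show False
    using simplex_with_circumcentre[OF assms s] by simp
qed

lemma irreducible_unit_mult:
  fixes p u :: "'a::idom"
  assumes "Factorial_Ring.irreducible p" and "u dvd 1"
  shows "Factorial_Ring.irreducible (u * p)"
proof (rule Factorial_Ring.irreducibleI)
  obtain v where v: "1 = u * v" using assms(2) by (rule dvdE)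
  have "v * (u * p) = (u * v) * p" by (simp only: mult_ac)
  then have p: "p = v * (u * p)" using v by simp
  have "p \<noteq> 0" and "\<not> p dvd 1" using assms(1) by (simp_all add: Factorial_Ring.irreducible_def)
  then show "u * p \<noteq> 0" and "\<not> u * p dvd 1"
    using assms(2) dvd_mult_right[of u p 1] by auto
  show "a dvd 1 \<or> b dvd 1" if "u * p = a * b" for a b
  proof -
    have "p = (v * a) * b" using p that by (simp add: mult.assoc)
    with assms(1) have "v * a dvd 1 \<or> b dvd 1" by (rule Factorial_Ring.irreducibleD)
    then show ?thesis using dvd_mult_right by blast
  qed
qed

lemma minus_two_dvd_one_mpoly: "(- 2 :: ('v, 'a::field_char_0) mpoly) dvd 1"
proof -
  have eq: "const (- 2) = (- 2 :: ('v, 'a) mpoly)"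
    by (simp add: const_def single_uminus)
  show ?thesis unfolding eq[symmetric] by (rule const_dvd_one) simp
qed

text \<open>
  A common divisor of an irreducible element with another element is a unit or an associate of
  the irreducible element; the second alternative is excluded by the preceding non-divisibility.
\<close>

lemma irreducible_cayley_menger_step:
  assumes "n \<ge> 2" and irr: "Factorial_Ring.irreducible (cayley_menger n :: (nat \<times> nat, complex) mpoly)"
  shows "Factorial_Ring.irreducible (cayley_menger (Suc n) :: (nat \<times> nat, complex) mpoly)"
proof (rule irreducible_cayley_menger_SucI)
  let ?G = "- 2 * (cayley_menger n :: (nat \<times> nat, complex) mpoly)"
  have irrG: "Factorial_Ring.irreducible ?G"
    by (rule irreducible_unit_mult[OF irr minus_two_dvd_one_mpoly])
  then show "Factorial_Ring.irreducible ?G \<or> (\<exists>l. prime_elem l \<and> l dvd ?G \<and> \<not> l\<^sup>2 dvd ?G)" ..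
  show "?G \<noteq> 0" using irrG by (metis Factorial_Ring.not_irreducible_zero)
  show "u dvd 1" if "u dvd ?G" "u dvd - dist_det n" for u
  proof (rule ccontr)
    assume "\<not> u dvd 1"
    obtain w where w: "?G = u * w" using \<open>u dvd ?G\<close> by (rule dvdE)
    have "w dvd 1" using Factorial_Ring.irreducibleD[OF irrG w] \<open>\<not> u dvd 1\<close> by blast
    moreover have "?G dvd u * w" using w by simp
    ultimately have "?G dvd u" by (rule dvd_unit_cancel)
    then have "cayley_menger n dvd u" by (rule dvd_mult_right)
    moreover have "u dvd dist_det n" using that(2) by (simp only: dvd_minus_iff)
    ultimately have "(cayley_menger n :: (nat \<times> nat, complex) mpoly) dvd dist_det n"
      by (rule dvd_trans)
    then show False using cayley_menger_not_dvd_dist_det[OF assms(1)] by blast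
  qed
qed


section \<open>Tetrahedra\<close>

text \<open>
  Expansion along the first row, in a form by which determinants of numerical size are
  evaluated by rewriting.
\<close>

lemma det_mat_Suc:
  fixes f :: "nat \<times> nat \<Rightarrow> 'a::comm_ring_1"
  shows "det (mat (Suc n) (Suc n) f)
    = (\<Sum>j<Suc n. (- 1) ^ j * f (0, j) * det (mat n n (\<lambda>(r, c). f (Suc r, if c < j then c else Suc c))))"
proof -
  have "det (mat (Suc n) (Suc n) f)
      = (\<Sum>j<Suc n. mat (Suc n) (Suc n) f $$ (0, j) * cofactor (mat (Suc n) (Suc n) f) 0 j)"
    by (rule laplace_expansion_row) auto
  also have "\<dots> = (\<Sum>j<Suc n. (- 1) ^ j * f (0, j) * det (mat n n (\<lambda>(r, c). f (Suc r, if c < j then c else Suc c))))"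
  proof (rule sum.cong)
    fix j assume "j \<in> {..<Suc n}"
    then have j: "j < Suc n" by simp
    have "mat_delete (mat (Suc n) (Suc n) f) 0 j = mat n n (\<lambda>(r, c). f (Suc r, if c < j then c else Suc c))"
      by (rule eq_matI) (use j in \<open>auto simp: mat_delete_def\<close>)
    then show "mat (Suc n) (Suc n) f $$ (0, j) * cofactor (mat (Suc n) (Suc n) f) 0 j
      = (- 1) ^ j * f (0, j) * det (mat n n (\<lambda>(r, c). f (Suc r, if c < j then c else Suc c)))"
      using j by (simp add: cofactor_def mult_ac)
  qed simp
  finally show ?thesis .
qed

lemma det_mat_0: "det (mat 0 0 f) = 1"
  by (rule det_dim_zero) simp

lemma det_bordered_3:
  fixes x y z :: "'a::comm_ring_1"
  assumes d: "d 0 1 = x" "d 1 0 = x" "d 0 2 = y" "d 2 0 = y" "d 1 2 = z" "d 2 1 = z"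
    "\<And>i. d i i = 0"
  shows "det (bordered 3 d) = x\<^sup>2 + y\<^sup>2 + z\<^sup>2 - 2 * (x * y + x * z + y * z)"
    and "det (unbordered 3 d) = 2 * (x * y * z)"
proof -
  note d' = d[unfolded numeral_2_eq_2 One_nat_def]
  show "det (bordered 3 d) = x\<^sup>2 + y\<^sup>2 + z\<^sup>2 - 2 * (x * y + x * z + y * z)"
    unfolding bordered_def numeral_3_eq_3 Suc_eq_plus1[symmetric]
    by (simp add: det_mat_Suc det_mat_0 d' lessThan_Suc)
       (simp add: power2_eq_square algebra_simps)
  show "det (unbordered 3 d) = 2 * (x * y * z)"
    unfolding unbordered_def numeral_3_eq_3
    by (simp add: det_mat_Suc det_mat_0 d' lessThan_Suc algebra_simps)
qed

text \<open>
  Heron's formula.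
\<close>

lemma cayley_menger_2:
  fixes a b c :: "(nat \<times> nat, 'a::comm_ring_1) mpoly"
  defines "a \<equiv> mvar (0, 1)" and "b \<equiv> mvar (0, 2)" and "c \<equiv> mvar (1, 2)"
  shows "cayley_menger 2 = - ((a + b + c) * ((b + c - a) * (a + c - b) * (a + b - c)))"
    and "dist_det 2 = 2 * (a * b * c)\<^sup>2"
proof -
  have d: "dist_sq 0 1 = a\<^sup>2" "dist_sq 1 0 = a\<^sup>2" "dist_sq 0 2 = b\<^sup>2" "dist_sq 2 0 = b\<^sup>2"
     "dist_sq 1 2 = c\<^sup>2" "dist_sq 2 1 = c\<^sup>2"
     "dist_sq i i = (0 :: (nat \<times> nat, 'a) mpoly)" for i
    by (simp_all add: dist_sq_def dvar_def a_def b_def c_def numeral_2_eq_2)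
  have three: "2 + 1 = (3::nat)" by simp
  show "cayley_menger 2 = - ((a + b + c) * ((b + c - a) * (a + c - b) * (a + b - c)))"
    unfolding cayley_menger_eq three det_bordered_3(1)[OF d]
    by (simp add: power2_eq_square algebra_simps)
  show "dist_det 2 = 2 * (a * b * c)\<^sup>2"
    unfolding dist_det_def three det_bordered_3(2)[OF d] by (simp add: power_mult_distrib)
qed

text \<open>
  For \<open>n = 2\<close> the determinant is reducible, so the induction cannot start there. Its factor
  \<open>a + b + c\<close> is a prime that occurs exactly once, and \<open>dist_det 2\<close> is a constant times a
  monomial, whose prime factors, the variables, do not divide Heron's product. So the quadratic criterion applies
  with the other alternative.
\<close>

lemma irreducible_cayley_menger_3:
  "Factorial_Ring.irreducible (cayley_menger 3 :: (nat \<times> nat, complex) mpoly)"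
proof -
  \<comment> \<open>Otherwise the index 1 of a variable is rewritten to \<open>Suc 0\<close> and no longer matches.\<close>
  note One_nat_def [simp del]
  let ?a = "mvar (0, 1) :: (nat \<times> nat, complex) mpoly"
  let ?b = "mvar (0, 2) :: (nat \<times> nat, complex) mpoly"
  let ?c = "mvar (1, 2) :: (nat \<times> nat, complex) mpoly"
  let ?l = "?a + ?b + ?c"
  let ?m = "(?b + ?c - ?a) * (?a + ?c - ?b) * (?a + ?b - ?c)"
  let ?G = "- 2 * (cayley_menger 2 :: (nat \<times> nat, complex) mpoly)"
  have G: "?G = ?l * (2 * ?m)"
    unfolding cayley_menger_2(1) by (simp only: mult_minus_left mult_minus_right minus_minus mult_ac)
  define ev :: "complex \<Rightarrow> complex \<Rightarrow> complex \<Rightarrow> (nat \<times> nat, complex) mpoly \<Rightarrow> complex"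
    where "ev x y z = subst (\<lambda>c. c) (\<lambda>v. if v = (0, 1) then x else if v = (0, 2) then y else z)"
    for x y z :: complex
  have ev_hom: "comm_ring_hom (ev x y z)" for x y z
    unfolding ev_def by (rule comm_ring_hom.comm_ring_hom_subst[OF comm_ring_hom_id])
  interpret ev: comm_ring_hom "ev x y z" for x y z by (rule ev_hom)
  have ev_dvd: "ev x y z p dvd ev x y z q" if "p dvd q" for x y z p q
    using that by (auto simp: dvd_def ev.hom_mult)
  have ev_abc: "ev x y z ?a = x" "ev x y z ?b = y" "ev x y z ?c = z" for x y z
    by (simp_all add: ev_def comm_ring_hom.subst_mvar[OF comm_ring_hom_id])
  have ev_2: "ev x y z 2 = 2" for x y z
    using ev.hom_add[of x y z 1 1] by simp
  have ev_l: "ev x y z ?l = x + y + z" for x y z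
    by (simp add: ev.hom_add ev_abc)
  have ev_minus: "ev x y z (p - q) = ev x y z p - ev x y z q" for x y z p q
    using ev.hom_add[of x y z "p - q" q] by simp
  have ev_m: "ev x y z (2 * ?m) = 2 * ((y + z - x) * (x + z - y) * (x + y - z))" for x y z
    by (simp add: ev.hom_mult ev.hom_add ev_minus ev_abc ev_2)
  have ev_G: "ev x y z ?G = (x + y + z) * (2 * ((y + z - x) * (x + z - y) * (x + y - z)))" for x y z
    unfolding G ev.hom_mult[of x y z ?l] ev_l ev_m ..
  have prime_l: "prime_elem ?l"
  proof (rule prime_elem_mpolyI[where f = "\<lambda>v. if v = (0, 1) then - ?b - ?c else mvar v"])
    have "ev 1 0 0 ?l \<noteq> ev 1 0 0 0"
      by (simp add: ev_l)
    then show "?l \<noteq> 0" by metis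
    let ?f = "\<lambda>v. if v = (0, 1) then - ?b - ?c else mvar v"
    interpret r: comm_ring_hom "subst const ?f :: _ \<Rightarrow> (nat \<times> nat, complex) mpoly"
      by (rule comm_ring_hom.comm_ring_hom_subst[OF comm_ring_hom_const])
    show "subst const ?f ?l = 0"
      by (simp add: r.hom_add comm_ring_hom.subst_mvar[OF comm_ring_hom_const])
    show "?l dvd mvar v - ?f v" for v
      by (auto simp: algebra_simps)
  qed
  have prime_var: "prime_elem (mvar v :: (nat \<times> nat, complex) mpoly)" for v
  proof (rule prime_elem_mpolyI[where f = "\<lambda>w. if w = v then 0 else mvar w"])
    show "mvar v \<noteq> (0 :: (nat \<times> nat, complex) mpoly)"
      unfolding mvar_def by (metis lookup_single_eq lookup_zero zero_neq_one)
    show "subst const (\<lambda>w. if w = v then 0 else mvar w) (mvar v) = (0 :: (nat \<times> nat, complex) mpoly)"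
      by (simp add: comm_ring_hom.subst_mvar[OF comm_ring_hom_const])
  qed auto
  \<comment> \<open>The point \<open>(1, 1, - 2)\<close> lies on \<open>a + b + c = 0\<close> but on none of the other three factors.\<close>
  have l2: "\<not> ?l\<^sup>2 dvd ?G"
  proof
    assume "?l\<^sup>2 dvd ?G"
    then have "?l * ?l dvd ?l * (2 * ?m)" unfolding G power2_eq_square .
    then have "?l dvd 2 * ?m" using prime_l by (simp only: dvd_mult_cancel_left) (auto simp: prime_elem_def)
    then have "ev 1 1 (- 2) ?l dvd ev 1 1 (- 2) (2 * ?m)" by (rule ev_dvd)
    then show False by (simp add: ev_l ev_m)
  qed
  have coprime: "u dvd 1" if uG: "u dvd ?G" and uH: "u dvd - dist_det 2" for u
  proof -
    have not_dvd: "\<not> p dvd u" if "ev x y z p = 0" "ev x y z ?G \<noteq> 0" for p x y z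
      using ev_dvd[OF dvd_trans[OF _ uG], of p x y z] that by auto
    \<comment> \<open>On each coordinate plane a point off the four factors is chosen.\<close>
    have a: "\<not> ?a dvd u" by (rule not_dvd[of 0 1 2]) (simp_all only: ev_abc ev_G, simp)
    have b: "\<not> ?b dvd u" by (rule not_dvd[of 1 0 2]) (simp_all only: ev_abc ev_G, simp)
    have c: "\<not> ?c dvd u" by (rule not_dvd[of 1 2 0]) (simp_all only: ev_abc ev_G, simp)
    have "- dist_det 2 = ?a * (?a * (?b * (?b * (?c * (?c * - 2)))))"
      unfolding cayley_menger_2(2) by (simp add: power2_eq_square mult_ac)
    with uH have "u dvd ?a * (?a * (?b * (?b * (?c * (?c * - 2)))))" by (simp only:)
    then have "u dvd - 2"
      using a b c by (blast dest: dvd_cancel_prime_factor[OF prime_var])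
    then show ?thesis using minus_two_dvd_one_mpoly by (rule dvd_trans)
  qed
  have "Factorial_Ring.irreducible (cayley_menger (Suc 2) :: (nat \<times> nat, complex) mpoly)"
  proof (rule irreducible_cayley_menger_SucI)
    show "?G \<noteq> 0" using l2 by (metis dvd_0_right)
    have "?l dvd ?G" unfolding G by (rule dvd_triv_left)
    then show "Factorial_Ring.irreducible ?G \<or> (\<exists>l. prime_elem l \<and> l dvd ?G \<and> \<not> l\<^sup>2 dvd ?G)"
      using prime_l l2 by blast
  qed (rule coprime)
  then show ?thesis by (simp add: numeral_3_eq_3 numeral_2_eq_2)
qed

section \<open>Irreducibility in all dimensions\<close>

lemma irreducible_cayley_menger:
  assumes "n \<ge> 3"
  shows "Factorial_Ring.irreducible (cayley_menger n :: (nat \<times> nat, complex) mpoly)"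
  using assms
  by (induction n rule: dec_induct)
     (simp_all add: irreducible_cayley_menger_3 irreducible_cayley_menger_step)

lemma sum_in_mpoly_ring:
  assumes "\<And>x. x \<in> A \<Longrightarrow> f x \<in> carrier (mpoly_ring V)"
  shows "sum f A \<in> carrier (mpoly_ring V)"
  using assms by (induction A rule: infinite_finite_induct) (auto intro: mpoly_ring_closed)

lemma prod_in_mpoly_ring:
  assumes "\<And>x. x \<in> A \<Longrightarrow> f x \<in> carrier (mpoly_ring V)"
  shows "prod f A \<in> carrier (mpoly_ring V)"
  using assms by (induction A rule: infinite_finite_induct) (auto intro: mpoly_ring_closed)

lemma const_in_mpoly_ring: "const c \<in> carrier (mpoly_ring V)"
  by (auto simp: mem_mpoly_ring const_def split: if_splits)

lemma dvar_in_mpoly_ring: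
  assumes "i \<le> n" "j \<le> n" "i \<noteq> j"
  shows "(dvar i j :: (nat \<times> nat, 'a::comm_ring_1) mpoly) \<in> carrier (mpoly_ring (dist_vars n))"
  using assms by (auto simp: mem_mpoly_ring dvar_def mvar_def dist_vars_def min_def max_def split: if_splits)

lemma cayley_menger_in_mpoly_ring:
  "(cayley_menger n :: (nat \<times> nat, 'a::comm_ring_1) mpoly) \<in> carrier (mpoly_ring (dist_vars n))"
proof -
  have entry: "CM n $$ (r, c) \<in> carrier (mpoly_ring (dist_vars n) :: (nat \<times> nat, 'a) mpoly ring)"
    if "r < n + 2" "c < n + 2" for r c
    using that by (auto simp: CM_def power2_eq_square intro!: mpoly_ring_closed dvar_in_mpoly_ring)
  have CM: "(CM n :: (nat \<times> nat, 'a) mpoly mat) \<in> carrier_mat (n + 2) (n + 2)"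
    by (simp add: CM_def)
  have sign: "signof p \<in> carrier (mpoly_ring (dist_vars n) :: (nat \<times> nat, 'a) mpoly ring)" for p
    by (cases p rule: sign_cases) (simp_all add: mpoly_ring_closed)
  have "det (CM n) \<in> carrier (mpoly_ring (dist_vars n) :: (nat \<times> nat, 'a) mpoly ring)"
    unfolding det_def'[OF CM]
  proof (intro sum_in_mpoly_ring prod_in_mpoly_ring mpoly_ring_closed(5) sign entry)
    fix p i assume "p \<in> {p. p permutes {0..<n + 2}}" and i: "i \<in> {0..<n + 2}"
    then have "p i \<in> {0..<n + 2}" by (simp only: mem_Collect_eq permutes_in_image)
    then show "i < n + 2" "p i < n + 2" using i by simp_all
  qed
  then show ?thesis by (simp add: cayley_menger_def)
qed

text \<open>
  A factor lying in the subring is a factor in the ring of polynomials in all variables, and the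
  units of both rings are the nonzero constants.
\<close>

lemma ring_irreducible_mpoly_ringI:
  fixes p :: "('v::linorder, 'a::field) mpoly"
  assumes irr: "Factorial_Ring.irreducible p"
  shows "ring_irreducible\<^bsub>mpoly_ring V\<^esub> p"
proof -
  let ?R = "mpoly_ring V :: ('v, 'a) mpoly ring"
  have Units: "q \<in> Units ?R \<longleftrightarrow> q dvd 1" for q
  proof
    assume "q \<in> Units ?R"
    then obtain q' where "q' * q = 1" by (auto simp: Units_def)
    then show "q dvd 1" by (metis dvd_triv_right)
  next
    assume "q dvd 1"
    then have q: "q = const (eval0 q)" by (rule mpoly_unit_is_const)
    have "eval0 q \<noteq> 0"
      using hom_dvd_one[OF comm_ring_hom_eval0 \<open>q dvd 1\<close>] by auto
    then have "q * const (1 / eval0 q) = 1"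
      by (subst q) (simp add: const_def mult_single)
    moreover have "q \<in> carrier ?R" by (subst q) (rule const_in_mpoly_ring)
    ultimately show "q \<in> Units ?R"
      unfolding Units_def using const_in_mpoly_ring[of "1 / eval0 q" V]
      by (auto intro!: bexI[of _ "const (1 / eval0 q)"] simp: mult.commute[of _ q])
  qed
  show ?thesis
    unfolding ring_irreducible_def
  proof (intro conjI)
    show "p \<noteq> \<zero>\<^bsub>?R\<^esub>" using irr by (metis Factorial_Ring.not_irreducible_zero mpoly_ring_simps(3))
    show "Divisibility.irreducible ?R p"
      unfolding Divisibility.irreducible_def
    proof (intro conjI ballI impI)
      show "p \<notin> Units ?R" unfolding Units by (rule Factorial_Ring.irreducible_not_unit[OF irr])
      fix q assume "q \<in> carrier ?R" and "properfactor ?R q p"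
      then obtain r where r: "r \<in> carrier ?R" "p = q * r" and nd: "\<not> p divides\<^bsub>?R\<^esub> q"
        by (auto simp: properfactor_def factor_def)
      have "\<not> r dvd 1"
      proof
        assume "r dvd 1"
        then obtain s where "s \<in> carrier ?R" "r * s = 1"
          unfolding Units[symmetric] by (auto simp: Units_def)
        then have "q = p * s" using r by (simp add: mult.assoc)
        then show False using nd \<open>s \<in> carrier ?R\<close> by (auto simp: factor_def)
      qed
      then show "q \<in> Units ?R" unfolding Units
        using Factorial_Ring.irreducibleD[OF irr r(2)] by blast
    qed
  qed
qed

theorem theorem1p1:
  fixes n :: nat
  assumes "n \<ge> 3"
  shows "(cayley_menger n :: (nat \<times> nat, complex) mpoly) \<in> carrier (mpoly_ring (dist_vars n)) \<and>
    ring_irreducible\<^bsub>mpoly_ring (dist_vars n)\<^esub> (cayley_menger n :: (nat \<times> nat, complex) mpoly)"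
  using cayley_menger_in_mpoly_ring ring_irreducible_mpoly_ringI[OF irreducible_cayley_menger[OF assms]]
  by blast

end
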